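(* There exist constants $c>0$ and $n_0$ such that for all $n\geq n_0$, the number of graphs on vertex set $[n]$ that have an even number of edges but have no even decomposition is at most $2^{\binom n2}\exp(-c\sqrt{\log n})$.
   Context: $\log$ is the natural logarithm. An even decomposition of a graph $H$ is a sequence of vertex sets $V(H)=V_0\supset V_1\supset\cdots\supset V_k=\emptyset$ such that for every $i\in[k]$, the set $V_{i-1}\setminus V_i$ is independent in $H$ and the number of edges of $H$ between $V_{i-1}\setminus V_i$ and $V_i$ is even. *)

theory Defs
  imports Complex_Main "HOL-Library.Ramsey"
begin

text \<open>
  A simple graph is given by a vertex set \<open>V\<close> and an edge set \<open>E \<subseteq> [V]\<^bsup>2\<^esup>\<close>.
  \<open>indep\<close> is the independence predicate of \<open>HOL-Library.Ramsey\<close>.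
\<close>

definition simple_graphs :: "'a set \<Rightarrow> 'a set set set" where
  "simple_graphs V = Pow ([V]\<^bsup>2\<^esup>)"

definition edges_between :: "'a set set \<Rightarrow> 'a set \<Rightarrow> 'a set \<Rightarrow> 'a set set" where
  "edges_between E A B = {e \<in> E. \<exists>a\<in>A. \<exists>b\<in>B. e = {a, b}}"

text \<open>
  The inclusions in the chain are strict. Allowing equalities would not change which graphs
  have an even decomposition, since repeated sets can be deleted from the chain.
\<close>

definition even_decomposition ::
    "'a set \<Rightarrow> 'a set set \<Rightarrow> nat \<Rightarrow> (nat \<Rightarrow> 'a set) \<Rightarrow> bool" where
  "even_decomposition V E k W \<longleftrightarrow>
     W 0 = V \<and> W k = {} \<and>
     (\<forall>i\<in>{1..k}. W i \<subset> W (i - 1) \<and>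
        indep (W (i - 1) - W i) E \<and>
        even (card (edges_between E (W (i - 1) - W i) (W i))))"

definition has_even_decomposition :: "'a set \<Rightarrow> 'a set set \<Rightarrow> bool" where
  "has_even_decomposition V E \<longleftrightarrow> (\<exists>k W. even_decomposition V E k W)"

end

theory Submission
  imports Defs
begin

text \<open>
  A vertex of even degree can be removed on its own, and two nonadjacent vertices of odd degree can
  be removed together. So removing vertices from \<open>U\<close> gets stuck only when \<open>U\<close> is a clique of
  vertices of odd degree. A further vertex \<open>w\<close> then allows \<open>u \<in> U\<close> to be removed, unless \<open>w\<close> has
  odd degree exactly when it is adjacent to \<open>u\<close>; hence any \<open>w\<close> adjacent to exactly one of two
  vertices of \<open>U\<close> allows one of them to be removed.

  Split the vertices into \<open>R\<close>, a set \<open>S\<close> of polylogarithmic size, and a much smaller independent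
  set \<open>I\<close>. Typically the cliques are small and every pair in \<open>R\<close> (in \<open>S\<close>) is separated by many
  vertices of \<open>S\<close> (of \<open>I\<close>). Removing \<open>R\<close> with the help of \<open>S\<close> leaves at most one vertex of \<open>R\<close>;
  removing what remains of \<open>R \<union> S\<close> with the help of \<open>I\<close> leaves a clique on at most two vertices of
  odd degree, with identical neighbourhoods in \<open>I\<close>. If it is nonempty, the remaining number of
  edges is odd, contradicting that the parity of the number of edges is invariant. Otherwise only
  an independent set is left.
\<close>

section \<open>Removing vertices\<close>

text \<open>One link of an even decomposition, written as a relation. Decompositions can then be
  built by following \<open>peel\<close> down to the empty set, without carrying an indexed chain
  along.\<close>

definition peel :: "'a set set \<Rightarrow> 'a set \<Rightarrow> 'a set \<Rightarrow> bool" where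
  "peel E A B \<longleftrightarrow> B \<subset> A \<and> indep (A - B) E \<and> even (card (edges_between E (A - B) B))"

definition nbh :: "'a set set \<Rightarrow> 'a set \<Rightarrow> 'a \<Rightarrow> 'a set" where
  "nbh E A v = {x \<in> A. {v, x} \<in> E}"

definition separators :: "'a set set \<Rightarrow> 'a \<Rightarrow> 'a \<Rightarrow> 'a set \<Rightarrow> 'a set" where
  "separators E u v W = {w \<in> W. ({u, w} \<in> E) \<noteq> ({v, w} \<in> E)}"

lemma has_even_decomposition_if_peel:
  assumes "(peel E)\<^sup>*\<^sup>* V {}"
  shows "has_even_decomposition V E"
  using assms
proof (induction rule: converse_rtranclp_induct)
  case base
  have "even_decomposition {} E 0 (\<lambda>_. {})"
    by (simp add: even_decomposition_def)
  then show ?case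
    unfolding has_even_decomposition_def by blast
next
  case (step A B)
  then obtain k W where W: "even_decomposition B E k W"
    unfolding has_even_decomposition_def by blast
  define W' where "W' = case_nat A W"
  have "W' i \<subset> W' (i - 1) \<and> indep (W' (i - 1) - W' i) E \<and>
        even (card (edges_between E (W' (i - 1) - W' i) (W' i)))" if "i \<in> {1..Suc k}" for i
  proof (cases "i = 1")
    case True
    then show ?thesis
      using step.hyps(1) W by (simp add: W'_def peel_def even_decomposition_def)
  next
    case False
    with that obtain j where j: "i = Suc (Suc j)" "Suc j \<in> {1..k}"
      by (cases i; cases "i - 1") auto
    then show ?thesis
      using W unfolding even_decomposition_def W'_def by fastforce
  qed
  moreover have "W' 0 = A" "W' (Suc k) = {}"
    using W by (auto simp: W'_def even_decomposition_def)
  ultimately have "even_decomposition A E (Suc k) W'"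
    unfolding even_decomposition_def by blast
  then show ?case
    unfolding has_even_decomposition_def by blast
qed

section \<open>Single removals and parity\<close>

text \<open>Since \<open>{v, v}\<close> collapses to \<open>{v}\<close>, a loop would make
  \<open>v\<close> its own neighbour. Without loops, the degree of \<open>v\<close> inside
  \<open>A\<close> equals the number of edges from \<open>v\<close> to the rest of
  \<open>A\<close>.\<close>

locale loopfree =
  fixes E :: "'a set set"
  assumes loopfree: "{v} \<notin> E"
begin

lemma card_edges_between:
  assumes "finite A" "finite B" "A \<inter> B = {}"
  shows "card (edges_between E A B) = (\<Sum>v\<in>A. card (nbh E B v))"
proof -
  have "edges_between E A B = (\<lambda>(a, b). {a, b}) ` (SIGMA v:A. nbh E B v)"
    unfolding edges_between_def nbh_def by auto
  moreover have "inj_on (\<lambda>(a, b). {a, b}) (SIGMA v:A. nbh E B v)"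
    using assms(3) unfolding inj_on_def nbh_def by (auto simp: doubleton_eq_iff)
  ultimately have "card (edges_between E A B) = card (SIGMA v:A. nbh E B v)"
    by (simp add: card_image)
  then show ?thesis
    using assms by (simp add: nbh_def)
qed

lemma peel_even_vertex:
  assumes "finite A" "v \<in> A" "even (card (nbh E A v))"
  shows "peel E A (A - {v})"
proof -
  have "A - (A - {v}) = {v}" using assms by auto
  moreover have "nbh E (A - {v}) v = nbh E A v"
    using loopfree by (auto simp: nbh_def)
  ultimately show ?thesis
    using assms card_edges_between[of "{v}" "A - {v}"]
    by (auto simp: peel_def indep_def)
qed

lemma peel_odd_pair:
  assumes "finite A" "u \<in> A" "v \<in> A" "u \<noteq> v" "{u, v} \<notin> E"
    "odd (card (nbh E A u))" "odd (card (nbh E A v))"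
  shows "peel E A (A - {u, v})"
proof -
  have *: "A - (A - {u, v}) = {u, v}" using assms by auto
  have "nbh E (A - {u, v}) u = nbh E A u" "nbh E (A - {u, v}) v = nbh E A v"
    using loopfree assms(5) by (auto simp: nbh_def insert_commute)
  then have "even (card (edges_between E {u, v} (A - {u, v})))"
    using assms card_edges_between[of "{u, v}" "A - {u, v}"] by simp
  then show ?thesis
    using assms * by (auto simp: peel_def indep_def insert_commute)
qed

text \<open>A helper \<open>w\<close> not adjacent to \<open>u\<close> is odd, and the two leave as
  an odd pair. An adjacent helper is even: it leaves first, which makes the degree of
  \<open>u\<close> even, and then \<open>u\<close> can follow.\<close>

lemma peel_with_helper:
  assumes "finite A" "u \<in> A" "w \<in> A" "u \<noteq> w" "odd (card (nbh E A u))"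
    "odd (card (nbh E A w)) \<longleftrightarrow> {u, w} \<notin> E"
  shows "(peel E)\<^sup>*\<^sup>* A (A - {u, w})"
proof (cases "{u, w} \<in> E")
  case False
  then show ?thesis
    using assms peel_odd_pair[of A u w] by auto
next
  case True
  have 1: "peel E A (A - {w})"
    using True assms peel_even_vertex[of A w] by auto
  have "nbh E A u = insert w (nbh E (A - {w}) u)"
    using True assms by (auto simp: nbh_def)
  then have "card (nbh E A u) = Suc (card (nbh E (A - {w}) u))"
    using assms(1) by (simp add: nbh_def)
  then have "peel E (A - {w}) (A - {w} - {u})"
    using assms peel_even_vertex[of "A - {w}" u] by auto
  moreover have "A - {w} - {u} = A - {u, w}" by auto
  ultimately show ?thesis
    using 1 by (metis (no_types, lifting) converse_rtranclp_into_rtranclp r_into_rtranclp)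
qed

lemma finite_edges_within: "finite A \<Longrightarrow> finite {e \<in> E. e \<subseteq> A}"
  by (rule finite_subset[of _ "Pow A"]) auto

text \<open>A removed set is independent, so the edges lost in one step are exactly those between it
  and what remains, and their number is even.\<close>

lemma peel_parity:
  assumes "E \<subseteq> [V]\<^bsup>2\<^esup>" "finite A" "(peel E)\<^sup>*\<^sup>* A B"
  shows "even (card {e \<in> E. e \<subseteq> A}) \<longleftrightarrow> even (card {e \<in> E. e \<subseteq> B})"
  using assms(3,2)
proof (induction rule: converse_rtranclp_induct)
  case (step A C)
  have sub: "C \<subset> A" and ind: "indep (A - C) E"
    and ev: "even (card (edges_between E (A - C) C))"
    using step.hyps(1) by (auto simp: peel_def)
  have split: "{e \<in> E. e \<subseteq> A} = {e \<in> E. e \<subseteq> C} \<union> edges_between E (A - C) C"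
  proof (intro equalityI subsetI)
    fix e assume e: "e \<in> {e \<in> E. e \<subseteq> A}"
    then obtain x y where xy: "e = {x, y}" "x \<noteq> y"
      using assms(1) by (auto simp: nsets_def card_2_iff)
    show "e \<in> {e \<in> E. e \<subseteq> C} \<union> edges_between E (A - C) C"
    proof (cases "x \<in> C"; cases "y \<in> C")
      assume "x \<notin> C" "y \<notin> C"
      then show ?thesis using xy e ind by (auto simp: indep_def)
    qed (use xy e in \<open>auto simp: edges_between_def insert_commute\<close>)
  qed (use sub in \<open>auto simp: edges_between_def\<close>)
  have "card {e \<in> E. e \<subseteq> A} = card {e \<in> E. e \<subseteq> C} + card (edges_between E (A - C) C)"
    unfolding split
  proof (rule card_Un_disjoint)
    show "finite {e \<in> E. e \<subseteq> C}" "finite (edges_between E (A - C) C)"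
      using finite_edges_within[OF step.prems] split by auto
  qed (auto simp: edges_between_def)
  moreover have "finite C" using sub step.prems finite_subset by blast
  ultimately show ?case using step.IH ev by simp
qed auto

text \<open>
  First \<open>U\<close> is shrunk without touching \<open>W\<close>. Once this is impossible, \<open>U\<close> is a clique of odd
  vertices, and from then on every vertex removed from \<open>U\<close> costs at most one vertex of \<open>W\<close>.
\<close>

lemma peel_until_homogeneous:
  assumes fin: "finite U" "finite W" "finite Z"
    and disj: "U \<inter> W = {}" "U \<inter> Z = {}" "W \<inter> Z = {}"
    and cl: "\<And>C. C \<subseteq> U \<Longrightarrow> clique C E \<Longrightarrow> card C \<le> L"
    and sep: "\<And>u v. u \<in> U - X \<Longrightarrow> v \<in> U - X \<Longrightarrow> u \<noteq> v \<Longrightarrow> L \<le> card (separators E u v W)"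
  obtains U' W' where "U' \<subseteq> U" "W' \<subseteq> W" "(peel E)\<^sup>*\<^sup>* (U \<union> W \<union> Z) (U' \<union> W' \<union> Z)"
    "clique U' E" "\<And>u. u \<in> U' \<Longrightarrow> odd (card (nbh E (U' \<union> W' \<union> Z) u))"
    "\<And>u w. u \<in> U' \<Longrightarrow> w \<in> W' \<Longrightarrow> odd (card (nbh E (U' \<union> W' \<union> Z) w)) \<longleftrightarrow> {u, w} \<in> E"
    "card (U' - X) \<le> 1"
proof -
  \<comment> \<open>The last conjunct is a budget. Once \<open>W\<close> has been touched, its
    losses plus the current size of \<open>U'\<close> stay at most \<open>L\<close>, so each vertex
    taken from \<open>W\<close> has to be paid for by one taken from \<open>U\<close>.\<close>
  define P where "P = (\<lambda>(U', W'). U' \<subseteq> U \<and> W' \<subseteq> W \<and>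
    (peel E)\<^sup>*\<^sup>* (U \<union> W \<union> Z) (U' \<union> W' \<union> Z) \<and> (W' = W \<or> card (W - W') + card U' \<le> L))"
  have "P (U, W)" by (auto simp: P_def)
  \<comment> \<open>Among all admissible reachable states, one with \<open>U'\<close> smallest is
    taken. Any way of shrinking \<open>U'\<close> further within the budget is then
    contradictory.\<close>
  then obtain p where p: "P p" and min: "\<And>p'. P p' \<Longrightarrow> card (fst p) \<le> card (fst p')"
    using exists_least_iff[of "\<lambda>k. \<exists>p. P p \<and> card (fst p) = k"]
    by (metis linorder_not_less)
  obtain U' W' where [simp]: "p = (U', W')" by (cases p)
  let ?A = "U' \<union> W' \<union> Z"
  have sub: "U' \<subseteq> U" "W' \<subseteq> W" and reach: "(peel E)\<^sup>*\<^sup>* (U \<union> W \<union> Z) ?A"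
    and cost: "W' = W \<or> card (W - W') + card U' \<le> L"
    using p by (auto simp: P_def)
  have fin': "finite U'" "finite W'" "finite ?A"
    using sub fin finite_subset by auto
  have stuck: False if "U'' \<subset> U'" "W'' \<subseteq> W'" "(peel E)\<^sup>*\<^sup>* ?A (U'' \<union> W'' \<union> Z)"
    "W'' = W \<or> card (W - W'') + card U'' \<le> L" for U'' W''
  proof -
    have "P (U'', W'')"
      using that sub rtranclp_trans[OF reach that(3)] by (auto simp: P_def)
    then show False
      using min psubset_card_mono[OF fin'(1) that(1)] by fastforce
  qed
  have stuck_U: False if "U'' \<subset> U'" "(peel E)\<^sup>*\<^sup>* ?A (U'' \<union> W' \<union> Z)" for U''
    using stuck[of U'' W'] that cost psubset_card_mono[OF fin'(1) that(1)] by auto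
  have odd: "odd (card (nbh E ?A u))" if "u \<in> U'" for u
  proof
    assume "even (card (nbh E ?A u))"
    then have "peel E ?A (?A - {u})"
      using peel_even_vertex fin' that by auto
    moreover have "?A - {u} = (U' - {u}) \<union> W' \<union> Z"
      using that sub disj by auto
    ultimately show False
      using stuck_U[of "U' - {u}"] that by auto
  qed
  have clique: "clique U' E"
    unfolding clique_def
  proof (intro ballI impI, rule ccontr)
    fix u v assume uv: "u \<in> U'" "v \<in> U'" "u \<noteq> v" "{u, v} \<notin> E"
    then have "peel E ?A (?A - {u, v})"
      using peel_odd_pair[of ?A u v] fin' odd by auto
    moreover have "?A - {u, v} = (U' - {u, v}) \<union> W' \<union> Z"
      using uv sub disj by auto
    ultimately show False
      using stuck_U[of "U' - {u, v}"] uv by auto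
  qed
  \<comment> \<open>If \<open>W\<close> is still untouched, the budget starts here:
    \<open>U'\<close> is a clique in \<open>U\<close> and thus has size at most
    \<open>L\<close>.\<close>
  have cost': "card (W - W') + card U' \<le> L"
    using cost cl[OF sub(1) clique] by auto
  have hom: "odd (card (nbh E ?A w)) \<longleftrightarrow> {u, w} \<in> E" if uw: "u \<in> U'" "w \<in> W'" for u w
  proof (rule ccontr)
    assume "\<not> ?thesis"
    moreover have ne: "u \<noteq> w" using uw sub disj by auto
    ultimately have "(peel E)\<^sup>*\<^sup>* ?A (?A - {u, w})"
      using peel_with_helper[of ?A u w] uw odd fin' by auto
    moreover have "?A - {u, w} = (U' - {u}) \<union> (W' - {w}) \<union> Z"
      using uw sub disj by auto
    moreover have "W - (W' - {w}) = insert w (W - W')" using uw sub by auto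
    then have "card (W - (W' - {w})) = Suc (card (W - W'))"
      using fin uw by simp
    then have "card (W - (W' - {w})) + card (U' - {u}) \<le> L"
      using cost' uw fin' card_gt_0_iff[of U'] by (auto simp: card_Diff_singleton)
    ultimately show False
      using stuck[of "U' - {u}" "W' - {w}"] uw by auto
  qed
  have "card (U' - X) \<le> 1"
  proof (rule ccontr)
    assume "\<not> ?thesis"
    then have "\<not> (\<forall>u\<in>U' - X. \<forall>v\<in>U' - X. u = v)"
      using card_le_Suc0_iff_eq[of "U' - X"] fin' by auto
    then obtain u v where uv: "u \<in> U' - X" "v \<in> U' - X" "u \<noteq> v" by blast
    \<comment> \<open>A vertex still in \<open>W'\<close> is adjacent to \<open>u\<close> exactly
      when it is odd, and likewise for \<open>v\<close>, so it separates nothing. All separators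
      have been spent, but the budget allows fewer than \<open>L\<close> losses while
      \<open>U'\<close> is nonempty.\<close>
    have "separators E u v W \<subseteq> W - W'"
      using hom[of u] hom[of v] uv by (auto simp: separators_def)
    then have "card (separators E u v W) \<le> card (W - W')"
      using fin by (intro card_mono) auto
    moreover have "card U' > 0" using uv fin' by (auto simp: card_gt_0_iff)
    ultimately show False
      using sep[of u v] uv sub cost' by fastforce
  qed
  then show thesis
    using that[of U' W'] sub reach clique odd hom by blast
qed

section \<open>Decomposing a graph with enough separators\<close>

text \<open>The helper argument is applied twice. In the second round a leftover vertex of
  \<open>R\<close> may enlarge a clique of \<open>S\<close> by one, whence \<open>l + 1\<close>
  separators in \<open>sepS\<close>.\<close>

lemma even_decomposition_if_separated:
  assumes E: "E \<subseteq> [R \<union> S \<union> I]\<^bsup>2\<^esup>" and ev: "even (card E)"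
    and fin: "finite R" "finite S" "finite I"
    and disj: "R \<inter> S = {}" "R \<inter> I = {}" "S \<inter> I = {}"
    and clR: "\<And>C. C \<subseteq> R \<Longrightarrow> clique C E \<Longrightarrow> card C \<le> L"
    and clS: "\<And>C. C \<subseteq> S \<Longrightarrow> clique C E \<Longrightarrow> card C \<le> l"
    and ind: "indep I E"
    and sepR: "\<And>u v. u \<in> R \<Longrightarrow> v \<in> R \<Longrightarrow> u \<noteq> v \<Longrightarrow> L \<le> card (separators E u v S)"
    and sepS: "\<And>u v. u \<in> S \<Longrightarrow> v \<in> S \<Longrightarrow> u \<noteq> v \<Longrightarrow> l + 1 \<le> card (separators E u v I)"
  shows "has_even_decomposition (R \<union> S \<union> I) E"
proof -
  \<comment> \<open>First round: \<open>S\<close> helps, \<open>I\<close> is kept in reserve as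
    \<open>Z\<close>, and no vertex is exempt from separation.\<close>
  obtain R' S' where R': "R' \<subseteq> R" "S' \<subseteq> S" "(peel E)\<^sup>*\<^sup>* (R \<union> S \<union> I) (R' \<union> S' \<union> I)"
    "card (R' - {}) \<le> 1"
    by (rule peel_until_homogeneous[OF fin disj, of L "{}"]) (use clR sepR in \<open>blast+\<close>)
  have fin': "finite R'" "finite S'" using R' fin finite_subset by auto
  have cl2: "card C \<le> l + 1" if "C \<subseteq> R' \<union> S'" "clique C E" for C
  proof -
    have "finite C" using that fin' finite_subset by blast
    have "card C \<le> card (C - R') + card R'"
      using diff_card_le_card_Diff[of R' C] fin' by linarith
    moreover have "card (C - R') \<le> l"
      by (rule clS) (use that R' in \<open>auto simp: clique_def\<close>)
    ultimately show ?thesis using R' by simp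
  qed
  have sep2: "l + 1 \<le> card (separators E u v I)"
    if "u \<in> (R' \<union> S') - R'" "v \<in> (R' \<union> S') - R'" "u \<noteq> v" for u v
    using sepS that R' by auto
  have disj2: "(R' \<union> S') \<inter> I = {}" using R' disj by auto
  \<comment> \<open>Second round: \<open>I\<close> helps. The at most one vertex of
    \<open>R'\<close> has no guaranteed separation in \<open>I\<close>, so \<open>R'\<close> takes
    the place of the exceptional set \<open>X\<close>.\<close>
  obtain U J where U: "U \<subseteq> R' \<union> S'" "J \<subseteq> I" "(peel E)\<^sup>*\<^sup>* (R' \<union> S' \<union> I) (U \<union> J)"
    "clique U E" "\<And>u. u \<in> U \<Longrightarrow> odd (card (nbh E (U \<union> J) u))"
    "\<And>u w. u \<in> U \<Longrightarrow> w \<in> J \<Longrightarrow> odd (card (nbh E (U \<union> J) w)) \<longleftrightarrow> {u, w} \<in> E"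
    "card (U - R') \<le> 1"
    by (rule peel_until_homogeneous[of "R' \<union> S'" I "{}" "l + 1" R'])
      (use fin fin' disj2 cl2 sep2 in \<open>simp; blast\<close>)+
  have finUJ: "finite U" "finite J" using U fin fin' finite_subset by blast+
  have reach: "(peel E)\<^sup>*\<^sup>* (R \<union> S \<union> I) (U \<union> J)"
    using R'(3) U(3) by (rule rtranclp_trans)
  have "{e \<in> E. e \<subseteq> R \<union> S \<union> I} = E" using E by (auto simp: nsets_def)
  then have "even (card {e \<in> E. e \<subseteq> U \<union> J})"
    using peel_parity[OF E _ reach] ev fin by simp
  have indJ: "indep J E" using ind U(2) by (auto simp: indep_def)
  have UJ: "U \<inter> J = {}" using U(1,2) disj2 by auto
  have "U = {}"
  proof (rule ccontr)
    assume "U \<noteq> {}"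
    have "card U \<le> card (U - R') + card R'"
      using diff_card_le_card_Diff[of R' U] fin' by linarith
    then have "card U \<le> 2" using U(7) R'(4) by simp
    moreover have "card U > 0" using \<open>U \<noteq> {}\<close> finUJ by (simp add: card_gt_0_iff)
    ultimately have "card U = 1 \<or> card U = 2" by linarith
    \<comment> \<open>A single vertex contributes its odd degree into \<open>J\<close>. Two adjacent
      vertices contribute their common edge and, having the same neighbours in \<open>J\<close>, an
      even number of further edges.\<close>
    then have "odd (card {e \<in> E. e \<subseteq> U \<union> J})"
    proof
      assume "card U = 1"
      then obtain u where u: "U = {u}" by (auto simp: card_1_singleton_iff)
      have "{e \<in> E. e \<subseteq> U \<union> J} = edges_between E {u} J"
      proof (intro equalityI subsetI)
        fix e assume e: "e \<in> {e \<in> E. e \<subseteq> U \<union> J}"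
        then obtain x y where "e = {x, y}" "x \<noteq> y"
          using E by (auto simp: nsets_def card_2_iff)
        then show "e \<in> edges_between E {u} J"
          using e u indJ by (auto simp: edges_between_def indep_def insert_commute)
      qed (auto simp: edges_between_def u)
      moreover have "nbh E (U \<union> J) u = nbh E J u" using u loopfree by (auto simp: nbh_def)
      ultimately show ?thesis
        using card_edges_between[of "{u}" J] U(5)[of u] u finUJ UJ by simp
    next
      assume "card U = 2"
      then obtain u v where u: "U = {u, v}" "u \<noteq> v" by (auto simp: card_2_iff)
      have uv: "{u, v} \<in> E" using U(4) u by (auto simp: clique_def)
      have "{e \<in> E. e \<subseteq> U \<union> J} = insert {u, v} (edges_between E {u, v} J)"
      proof (intro equalityI subsetI)
        fix e assume e: "e \<in> {e \<in> E. e \<subseteq> U \<union> J}"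
        then obtain x y where "e = {x, y}" "x \<noteq> y"
          using E by (auto simp: nsets_def card_2_iff)
        then show "e \<in> insert {u, v} (edges_between E {u, v} J)"
          using e u indJ by (auto simp: edges_between_def indep_def insert_commute)
      qed (use u uv in \<open>auto simp: edges_between_def\<close>)
      moreover have "{u, v} \<notin> edges_between E {u, v} J"
        using UJ u by (auto simp: edges_between_def doubleton_eq_iff)
      moreover have "finite (edges_between E {u, v} J)"
        by (rule finite_subset[OF _ finite_edges_within[of "U \<union> J"]])
          (use finUJ u in \<open>auto simp: edges_between_def\<close>)
      moreover have "nbh E J u = nbh E J v"
        using U(6)[of u] U(6)[of v] u by (auto simp: nbh_def)
      then have "even (card (edges_between E {u, v} J))"
        using card_edges_between[of "{u, v}" J] u finUJ UJ by simp
      ultimately show ?thesis by simp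
    qed
    with \<open>even (card {e \<in> E. e \<subseteq> U \<union> J})\<close> show False by blast
  qed
  have "(peel E)\<^sup>*\<^sup>* J {}"
  \<comment> \<open>The independent set \<open>J\<close> goes in one step. As \<open>peel\<close>
    demands strict inclusion, an empty \<open>J\<close> takes no step at all.\<close>
  proof (cases "J = {}")
    case False
    then have "peel E J {}" using indJ by (auto simp: peel_def edges_between_def)
    then show ?thesis by blast
  qed auto
  then have "(peel E)\<^sup>*\<^sup>* (R \<union> S \<union> I) {}"
    using reach \<open>U = {}\<close> by (auto intro: rtranclp_trans)
  then show ?thesis by (rule has_even_decomposition_if_peel)
qed

end

section \<open>Counting graphs\<close>

text \<open>For finite \<open>X\<close> this is the probability that a uniformly random subset of
  \<open>X\<close> satisfies \<open>Q\<close>. With \<open>X\<close> the set of pairs of vertices,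
  it refers to the uniform random graph.\<close>

definition freq :: "'b set \<Rightarrow> ('b set \<Rightarrow> bool) \<Rightarrow> real" where
  "freq X Q = real (card {E. E \<subseteq> X \<and> Q E}) / 2 ^ card X"

lemma freq_nonneg: "freq X Q \<ge> 0"
  by (simp add: freq_def)

lemma freq_mono:
  assumes "finite X" "\<And>E. E \<subseteq> X \<Longrightarrow> Q E \<Longrightarrow> R E"
  shows "freq X Q \<le> freq X R"
  unfolding freq_def using assms
  by (intro divide_right_mono of_nat_mono card_mono) auto

lemma freq_cong:
  assumes "\<And>E. E \<subseteq> X \<Longrightarrow> Q E \<longleftrightarrow> R E"
  shows "freq X Q = freq X R"
  unfolding freq_def using assms by (metis (mono_tags, lifting) Collect_cong)

lemma freq_True: "finite X \<Longrightarrow> freq X (\<lambda>_. True) = 1"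
  by (simp add: freq_def card_Pow flip: Pow_def)

lemma freq_eq_single:
  assumes "A \<subseteq> X"
  shows "freq X (\<lambda>E. E = A) = 1 / 2 ^ card X"
proof -
  have "{E. E \<subseteq> X \<and> E = A} = {A}" using assms by auto
  then show ?thesis by (simp add: freq_def)
qed

lemma freq_disj:
  assumes "finite X"
  shows "freq X (\<lambda>E. Q E \<or> R E) \<le> freq X Q + freq X R"
proof -
  have "{E. E \<subseteq> X \<and> (Q E \<or> R E)} = {E. E \<subseteq> X \<and> Q E} \<union> {E. E \<subseteq> X \<and> R E}" by auto
  then have "card {E. E \<subseteq> X \<and> (Q E \<or> R E)} \<le> card {E. E \<subseteq> X \<and> Q E} + card {E. E \<subseteq> X \<and> R E}"
    by (simp add: card_Un_le)
  then show ?thesis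
    unfolding freq_def by (simp add: divide_right_mono flip: add_divide_distrib of_nat_add)
qed

lemma freq_Not:
  assumes "finite X"
  shows "freq X (\<lambda>E. \<not> Q E) = 1 - freq X Q"
proof -
  have "Pow X = {E. E \<subseteq> X \<and> Q E} \<union> {E. E \<subseteq> X \<and> \<not> Q E}" by auto
  moreover have "{E. E \<subseteq> X \<and> Q E} \<inter> {E. E \<subseteq> X \<and> \<not> Q E} = {}" by auto
  ultimately have "card (Pow X) = card {E. E \<subseteq> X \<and> Q E} + card {E. E \<subseteq> X \<and> \<not> Q E}"
    using assms by (simp add: card_Un_disjoint)
  then have "2 ^ card X = real (card {E. E \<subseteq> X \<and> Q E}) + real (card {E. E \<subseteq> X \<and> \<not> Q E})"
    using assms by (simp add: card_Pow flip: of_nat_add)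
  then have "real (card {E. E \<subseteq> X \<and> \<not> Q E}) = 2 ^ card X - real (card {E. E \<subseteq> X \<and> Q E})"
    by simp
  then show ?thesis
    by (simp add: freq_def diff_divide_distrib)
qed

lemma freq_Bex:
  assumes "finite X" "finite J"
  shows "freq X (\<lambda>E. \<exists>j\<in>J. Q j E) \<le> (\<Sum>j\<in>J. freq X (Q j))"
  using assms(2)
proof (induction J)
  case empty
  then show ?case by (simp add: freq_def)
next
  case (insert j J)
  have "freq X (\<lambda>E. \<exists>i\<in>insert j J. Q i E) \<le> freq X (Q j) + freq X (\<lambda>E. \<exists>i\<in>J. Q i E)"
    using freq_disj[OF assms(1), of "Q j" "\<lambda>E. \<exists>i\<in>J. Q i E"] by simp
  then show ?case using insert by simp
qed

text \<open>Independence of events that look at disjoint sets of coordinates: a subset of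
  \<open>F \<union> G\<close> is an arbitrary pair of a subset of \<open>F\<close> and a subset of
  \<open>G\<close>.\<close>

lemma freq_conj:
  assumes "finite F" "finite G" "F \<inter> G = {}"
  shows "freq (F \<union> G) (\<lambda>E. Q (E \<inter> F) \<and> R (E \<inter> G)) = freq F Q * freq G R"
proof -
  let ?S = "{E. E \<subseteq> F \<union> G \<and> Q (E \<inter> F) \<and> R (E \<inter> G)}"
  let ?T = "{A. A \<subseteq> F \<and> Q A} \<times> {B. B \<subseteq> G \<and> R B}"
  have "bij_betw (\<lambda>E. (E \<inter> F, E \<inter> G)) ?S ?T"
  proof (rule bij_betw_byWitness[where f' = "\<lambda>(A, B). A \<union> B"])
    have "(A \<union> B) \<inter> F = A \<and> (A \<union> B) \<inter> G = B" if "A \<subseteq> F" "B \<subseteq> G" for A B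
      using that assms(3) by blast
    then show "\<forall>p\<in>?T. (\<lambda>E. (E \<inter> F, E \<inter> G)) ((\<lambda>(A, B). A \<union> B) p) = p"
      and "(\<lambda>(A, B). A \<union> B) ` ?T \<subseteq> ?S"
      by auto
  qed auto
  then have "card ?S = card {A. A \<subseteq> F \<and> Q A} * card {B. B \<subseteq> G \<and> R B}"
    by (simp add: bij_betw_same_card card_cartesian_product)
  then show ?thesis
    using assms by (simp add: freq_def card_Un_disjoint power_add)
qed

lemma freq_restrict:
  assumes "finite X" "F \<subseteq> X"
  shows "freq X (\<lambda>E. Q (E \<inter> F)) = freq F Q"
proof -
  have "finite F" "F \<union> (X - F) = X" using assms finite_subset by auto
  then show ?thesis
    using freq_conj[of F "X - F" Q "\<lambda>_. True"] assms by (simp add: freq_True)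
qed

text \<open>Mutual independence of events on pairwise disjoint coordinate sets. The induction splits
  off \<open>F j\<close> and places all other events on its complement, which is why
  \<open>X\<close> has to vary.\<close>

lemma freq_Ball:
  assumes "finite J" "finite X" "\<And>j. j \<in> J \<Longrightarrow> F j \<subseteq> X"
    "\<And>i j. i \<in> J \<Longrightarrow> j \<in> J \<Longrightarrow> i \<noteq> j \<Longrightarrow> F i \<inter> F j = {}"
  shows "freq X (\<lambda>E. \<forall>j\<in>J. Q j (E \<inter> F j)) = (\<Prod>j\<in>J. freq (F j) (Q j))"
  using assms
proof (induction J arbitrary: X)
  case empty
  then show ?case by (simp add: freq_True)
next
  case (insert j J)
  let ?G = "X - F j"
  have X: "F j \<union> ?G = X" "finite (F j)"
    using insert.prems(2)[of j] finite_subset[OF _ insert.prems(1)] by auto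
  have G: "F i \<subseteq> ?G" if "i \<in> J" for i
  proof -
    have "F i \<inter> F j = {}" using insert.prems(3)[of i j] insert.hyps that by auto
    then show ?thesis using insert.prems(2)[of i] that by auto
  qed
  then have "E \<inter> ?G \<inter> F i = E \<inter> F i" if "i \<in> J" for E i using that by blast
  then have "freq X (\<lambda>E. \<forall>i\<in>insert j J. Q i (E \<inter> F i)) =
      freq (F j \<union> ?G) (\<lambda>E. Q j (E \<inter> F j) \<and> (\<forall>i\<in>J. Q i (E \<inter> ?G \<inter> F i)))"
    using X by (intro arg_cong2[where f = freq]) auto
  also have "\<dots> = freq (F j) (Q j) * freq ?G (\<lambda>E. \<forall>i\<in>J. Q i (E \<inter> F i))"
    using X insert.prems by (intro freq_conj) auto
  also have "freq ?G (\<lambda>E. \<forall>i\<in>J. Q i (E \<inter> F i)) = (\<Prod>j\<in>J. freq (F j) (Q j))"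
    using insert.prems G by (intro insert.IH) auto
  finally show ?case using insert.hyps by simp
qed

lemma freq_pair:
  assumes "a \<noteq> b"
  shows "freq {a, b} (\<lambda>A. ((a \<in> A) \<noteq> (b \<in> A)) = c) = 1 / 2"
proof -
  have "A \<subseteq> {a, b} \<longleftrightarrow> A \<in> {{}, {a}, {b}, {a, b}}" for A
    by blast
  then have "{A. A \<subseteq> {a, b} \<and> (((a \<in> A) \<noteq> (b \<in> A)) = c)} =
      {A \<in> {{}, {a}, {b}, {a, b}}. ((a \<in> A) \<noteq> (b \<in> A)) = c}"
    by simp
  also have "\<dots> = (if c then {{a}, {b}} else {{}, {a, b}})"
    using assms by auto
  also have "card \<dots> = 2" using assms by simp
  finally show ?thesis using assms by (simp add: freq_def)
qed

section \<open>Cliques and separators in a random graph\<close>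

lemma choose_le_pow: "n choose k \<le> n ^ k"
  by (cases "k \<le> n") (auto simp: binomial_le_pow binomial_eq_0)

text \<open>Union bound over the \<open>t\<close>-subsets of \<open>A\<close>, each of which is a
  clique with probability \<open>1 / 2 ^ (t choose 2)\<close>.\<close>

lemma freq_clique:
  assumes "finite V" "A \<subseteq> V"
  shows "freq ([V]\<^bsup>2\<^esup>) (\<lambda>E. \<exists>C\<subseteq>A. card C = t \<and> clique C E) \<le> real (card A) ^ t / 2 ^ (t choose 2)"
proof -
  let ?X = "[V]\<^bsup>2\<^esup>"
  have fin: "finite ?X" "finite A" using assms finite_subset by (auto simp: finite_imp_finite_nsets)
  have "freq ?X (\<lambda>E. \<exists>C\<subseteq>A. card C = t \<and> clique C E) \<le> freq ?X (\<lambda>E. \<exists>C\<in>[A]\<^bsup>t\<^esup>. clique C E)"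
    using fin by (intro freq_mono) (auto simp: nsets_def intro: finite_subset)
  also have "\<dots> \<le> (\<Sum>C\<in>[A]\<^bsup>t\<^esup>. freq ?X (clique C))"
    using fin by (intro freq_Bex) (auto simp: finite_imp_finite_nsets)
  also have "\<dots> \<le> (\<Sum>C\<in>[A]\<^bsup>t\<^esup>. 1 / 2 ^ (t choose 2))"
  proof (rule sum_mono)
    fix C assume C: "C \<in> [A]\<^bsup>t\<^esup>"
    have "freq ?X (clique C) \<le> freq ?X (\<lambda>E. E \<inter> [C]\<^bsup>2\<^esup> = [C]\<^bsup>2\<^esup>)"
      using fin by (intro freq_mono) (auto simp: clique_def elim!: nsets2_E)
    also have "\<dots> = freq ([C]\<^bsup>2\<^esup>) (\<lambda>E. E = [C]\<^bsup>2\<^esup>)"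
      using fin C assms by (intro freq_restrict[of ?X "[C]\<^bsup>2\<^esup>" "\<lambda>E. E = [C]\<^bsup>2\<^esup>"] nsets_mono)
        (auto simp: nsets_def)
    also have "\<dots> = 1 / 2 ^ (t choose 2)"
      using C by (simp add: freq_eq_single) (simp add: nsets_def)
    finally show "freq ?X (clique C) \<le> 1 / 2 ^ (t choose 2)" .
  qed
  also have "\<dots> = real (card A choose t) / 2 ^ (t choose 2)" by simp
  also have "\<dots> \<le> real (card A) ^ t / 2 ^ (t choose 2)"
    using choose_le_pow[of "card A" t] by (intro divide_right_mono) (auto simp flip: of_nat_power)
  finally show ?thesis .
qed

lemma card_small_subsets:
  assumes "finite W" "W \<noteq> {}"
  shows "card {T. T \<subseteq> W \<and> card T < L} \<le> L * card W ^ L"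
proof -
  have "{T. T \<subseteq> W \<and> card T < L} = (\<Union>i\<in>{..<L}. [W]\<^bsup>i\<^esup>)"
    using assms by (auto simp: nsets_def intro: finite_subset)
  then have "card {T. T \<subseteq> W \<and> card T < L} \<le> (\<Sum>i<L. card ([W]\<^bsup>i\<^esup>))"
    using card_UN_le[of "{..<L}" "nsets W"] by simp
  also have "\<dots> \<le> (\<Sum>i<L. card W ^ L)"
  proof (rule sum_mono)
    fix i assume i: "i \<in> {..<L}"
    have "card ([W]\<^bsup>i\<^esup>) \<le> card W ^ i" by (simp add: choose_le_pow)
    also have "\<dots> \<le> card W ^ L"
      using i assms by (intro power_increasing) (auto simp: Suc_le_eq card_gt_0_iff)
    finally show "card ([W]\<^bsup>i\<^esup>) \<le> card W ^ L" .
  qed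
  finally show ?thesis by simp
qed

text \<open>Each \<open>w\<close> separates \<open>u\<close> from \<open>v\<close> with probability
  one half, independently of the others. So the set of separators is a uniformly random subset of
  \<open>W\<close>, and it remains to count small subsets.\<close>

lemma freq_few_separators:
  assumes "finite X" "finite W" "W \<noteq> {}" "u \<noteq> v" "u \<notin> W" "v \<notin> W"
    "\<And>w. w \<in> W \<Longrightarrow> {u, w} \<in> X \<and> {v, w} \<in> X"
  shows "freq X (\<lambda>E. card (separators E u v W) < L) \<le> real L * real (card W) ^ L / 2 ^ card W"
proof -
  let ?T = "{T. T \<subseteq> W \<and> card T < L}"
  have "freq X (\<lambda>E. card (separators E u v W) < L) \<le> freq X (\<lambda>E. \<exists>T\<in>?T. separators E u v W = T)"
    using assms by (intro freq_mono) (auto simp: separators_def)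
  also have "\<dots> \<le> (\<Sum>T\<in>?T. freq X (\<lambda>E. separators E u v W = T))"
    using assms by (intro freq_Bex) auto
  also have "\<dots> = (\<Sum>T\<in>?T. 1 / 2 ^ card W)"
  proof (rule sum.cong[OF refl])
    fix T assume T: "T \<in> ?T"
    \<comment> \<open>The two pairs that decide whether \<open>w\<close> separates. For distinct
      \<open>w\<close> they are disjoint because neither \<open>u\<close> nor \<open>v\<close> lies
      in \<open>W\<close>.\<close>
    define F where "F = (\<lambda>w. {{u, w}, {v, w}})"
    define Q where "Q = (\<lambda>w A. (({u, w} \<in> A) \<noteq> ({v, w} \<in> A)) = (w \<in> T))"
    have "freq X (\<lambda>E. separators E u v W = T) = freq X (\<lambda>E. \<forall>w\<in>W. Q w (E \<inter> F w))"
      using T by (intro freq_cong) (auto simp: separators_def Q_def F_def)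
    also have "\<dots> = (\<Prod>w\<in>W. freq (F w) (Q w))"
      using assms by (intro freq_Ball) (auto simp: F_def doubleton_eq_iff)
    also have "\<dots> = (\<Prod>w\<in>W. 1 / 2)"
    proof (rule prod.cong[OF refl])
      fix w assume "w \<in> W"
      have ne: "{u, w} \<noteq> {v, w}" using assms(4) by (auto simp: doubleton_eq_iff)
      then show "freq (F w) (Q w) = 1 / 2"
        unfolding F_def Q_def by (rule freq_pair)
    qed
    also have "\<dots> = 1 / 2 ^ card W" by (simp add: power_one_over)
    finally show "freq X (\<lambda>E. separators E u v W = T) = 1 / 2 ^ card W" .
  qed
  also have "\<dots> = real (card ?T) / 2 ^ card W" by simp
  also have "\<dots> \<le> real L * real (card W) ^ L / 2 ^ card W"
    using card_small_subsets[OF assms(2,3), of L]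
    by (intro divide_right_mono) (auto simp flip: of_nat_power of_nat_mult)
  finally show ?thesis .
qed

lemma freq_some_pair_few_separators:
  assumes "finite X" "finite W" "W \<noteq> {}" "finite A" "A \<inter> W = {}"
    "\<And>u w. u \<in> A \<Longrightarrow> w \<in> W \<Longrightarrow> {u, w} \<in> X"
  shows "freq X (\<lambda>E. \<exists>u\<in>A. \<exists>v\<in>A. u \<noteq> v \<and> card (separators E u v W) < L)
    \<le> real (card A) ^ 2 * (real L * real (card W) ^ L / 2 ^ card W)"
proof -
  let ?b = "real L * real (card W) ^ L / 2 ^ card W"
  have "freq X (\<lambda>E. \<exists>u\<in>A. \<exists>v\<in>A. u \<noteq> v \<and> card (separators E u v W) < L)
      \<le> freq X (\<lambda>E. \<exists>p\<in>A \<times> A. fst p \<noteq> snd p \<and> card (separators E (fst p) (snd p) W) < L)"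
    using assms by (intro freq_mono) force+
  also have "\<dots> \<le> (\<Sum>p\<in>A \<times> A. freq X (\<lambda>E. fst p \<noteq> snd p \<and> card (separators E (fst p) (snd p) W) < L))"
    using assms by (intro freq_Bex) auto
  also have "\<dots> \<le> (\<Sum>p\<in>A \<times> A. ?b)"
  proof (rule sum_mono)
    fix p assume p: "p \<in> A \<times> A"
    show "freq X (\<lambda>E. fst p \<noteq> snd p \<and> card (separators E (fst p) (snd p) W) < L) \<le> ?b"
    proof (cases "fst p = snd p")
      case True
      then show ?thesis by (simp add: freq_def)
    next
      case False
      then show ?thesis
        using freq_few_separators[of X W "fst p" "snd p" L] assms p by fastforce
    qed
  qed
  also have "\<dots> = real (card A) ^ 2 * ?b"
    using assms by (simp add: card_cartesian_product power2_eq_square)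
  finally show ?thesis .
qed

text \<open>
  Good blocks are sought among disjoint candidates. The sets \<open>block_edges\<close> are then disjoint too,
  so the candidates fail independently.
\<close>

definition good_block :: "nat \<Rightarrow> 'a set \<Rightarrow> 'a set \<Rightarrow> 'a set set \<Rightarrow> bool" where
  "good_block l S I E \<longleftrightarrow> indep I E \<and>
     (\<forall>u\<in>S. \<forall>v\<in>S. u \<noteq> v \<longrightarrow> l \<le> card (separators E u v I))"

definition block_edges :: "'a set \<Rightarrow> 'a set \<Rightarrow> 'a set set" where
  "block_edges S I = [I]\<^bsup>2\<^esup> \<union> (\<Union>s\<in>S. \<Union>i\<in>I. {{s, i}})"

lemma good_block_restrict: "good_block l S I (E \<inter> block_edges S I) \<longleftrightarrow> good_block l S I E"
proof -
  have "indep I (E \<inter> block_edges S I) \<longleftrightarrow> indep I E"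
    by (auto simp: indep_def block_edges_def)
  moreover have "separators (E \<inter> block_edges S I) u v I = separators E u v I" if "u \<in> S" "v \<in> S" for u v
    using that unfolding separators_def block_edges_def by blast
  ultimately show ?thesis unfolding good_block_def by simp
qed

text \<open>Independence of \<open>I\<close> concerns pairs inside \<open>I\<close>, and separation
  concerns pairs between \<open>S\<close> and \<open>I\<close>. The probabilities therefore
  multiply, and a union bound controls the second factor.\<close>

lemma freq_good_block:
  assumes "finite S" "finite I" "I \<noteq> {}" "S \<inter> I = {}"
  shows "freq (block_edges S I) (good_block l S I) \<ge>
    1 / 2 ^ (card I choose 2) * (1 - real (card S) ^ 2 * (real l * real (card I) ^ l / 2 ^ card I))"
proof -
  define G where "G = (\<Union>s\<in>S. \<Union>i\<in>I. {{s, i}})"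
  define Q where "Q = (\<lambda>E. \<forall>u\<in>S. \<forall>v\<in>S. u \<noteq> v \<longrightarrow> l \<le> card (separators E u v I))"
  have fin: "finite G" "finite ([I]\<^bsup>2\<^esup>)" using assms by (auto simp: G_def finite_imp_finite_nsets)
  have disj: "[I]\<^bsup>2\<^esup> \<inter> G = {}" using assms by (auto simp: G_def)
  have "freq (block_edges S I) (good_block l S I)
      = freq ([I]\<^bsup>2\<^esup> \<union> G) (\<lambda>E. E \<inter> [I]\<^bsup>2\<^esup> = {} \<and> Q (E \<inter> G))"
    unfolding block_edges_def G_def[symmetric]
  proof (rule freq_cong)
    fix E
    have "indep I E \<longleftrightarrow> E \<inter> [I]\<^bsup>2\<^esup> = {}" by (auto simp: indep_def elim!: nsets2_E)
    moreover have "separators (E \<inter> G) u v I = separators E u v I" if "u \<in> S" "v \<in> S" for u v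
      using that unfolding separators_def G_def by blast
    ultimately show "good_block l S I E \<longleftrightarrow> E \<inter> [I]\<^bsup>2\<^esup> = {} \<and> Q (E \<inter> G)"
      unfolding good_block_def Q_def by simp
  qed
  also have "\<dots> = freq ([I]\<^bsup>2\<^esup>) (\<lambda>E. E = {}) * freq G Q"
    by (rule freq_conj[OF fin(2,1) disj])
  also have "freq ([I]\<^bsup>2\<^esup>) (\<lambda>E. E = {}) = 1 / 2 ^ (card I choose 2)"
    by (simp add: freq_eq_single)
  also have "freq G Q = 1 - freq G (\<lambda>E. \<exists>u\<in>S. \<exists>v\<in>S. u \<noteq> v \<and> card (separators E u v I) < l)"
    unfolding freq_Not[OF fin(1), symmetric] Q_def
    by (intro freq_cong) (auto simp: not_less)
  also have "1 / 2 ^ (card I choose 2) * \<dots> \<ge> 1 / 2 ^ (card I choose 2) *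
      (1 - real (card S) ^ 2 * (real l * real (card I) ^ l / 2 ^ card I))"
    using freq_some_pair_few_separators[of G I S l] fin assms
    by (intro mult_left_mono) (auto simp: G_def)
  finally show ?thesis .
qed

lemma freq_no_good_block:
  assumes "finite V" "S \<subseteq> V" "finite J" "k > 0"
    and I: "\<And>j. j \<in> J \<Longrightarrow> I j \<subseteq> V - S \<and> card (I j) = k"
    and disj: "\<And>i j. i \<in> J \<Longrightarrow> j \<in> J \<Longrightarrow> i \<noteq> j \<Longrightarrow> I i \<inter> I j = {}"
  shows "freq ([V]\<^bsup>2\<^esup>) (\<lambda>E. \<forall>j\<in>J. \<not> good_block l S (I j) E) \<le>
    (1 - 1 / 2 ^ (k choose 2) * (1 - real (card S) ^ 2 * (real l * real k ^ l / 2 ^ k))) ^ card J"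
proof -
  let ?b = "1 - 1 / 2 ^ (k choose 2) * (1 - real (card S) ^ 2 * (real l * real k ^ l / 2 ^ k))"
  have fin: "finite S" "finite ([V]\<^bsup>2\<^esup>)"
    using assms finite_subset by (auto simp: finite_imp_finite_nsets)
  have "freq ([V]\<^bsup>2\<^esup>) (\<lambda>E. \<forall>j\<in>J. \<not> good_block l S (I j) E) =
      freq ([V]\<^bsup>2\<^esup>) (\<lambda>E. \<forall>j\<in>J. \<not> good_block l S (I j) (E \<inter> block_edges S (I j)))"
    by (simp add: good_block_restrict)
  also have "\<dots> = (\<Prod>j\<in>J. freq (block_edges S (I j)) (\<lambda>E. \<not> good_block l S (I j) E))"
  proof (rule freq_Ball[OF assms(3) fin(2), where Q = "\<lambda>j E. \<not> good_block l S (I j) E"])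
    show "block_edges S (I j) \<subseteq> [V]\<^bsup>2\<^esup>" if "j \<in> J" for j
      using I[OF that] assms(2) nsets_mono[of "I j" V 2] by (auto simp: block_edges_def)
    show "block_edges S (I i) \<inter> block_edges S (I j) = {}" if ij: "i \<in> J" "j \<in> J" "i \<noteq> j" for i j
    proof -
      \<comment> \<open>A pair of a block meets that block and otherwise stays in \<open>S\<close>,
        so it cannot belong to a disjoint block as well.\<close>
      have meet: "e \<inter> I i \<noteq> {} \<and> e \<subseteq> S \<union> I i" if "e \<in> block_edges S (I i)" for e i
        using that by (auto simp: block_edges_def elim!: nsets2_E)
      show ?thesis
        using meet[of _ i] meet[of _ j] disj[OF ij] I[OF ij(1)] I[OF ij(2)] by blast
    qed
  qed
  also have "\<dots> \<le> (\<Prod>j\<in>J. ?b)"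
  proof (rule prod_mono, intro conjI freq_nonneg)
    fix j assume j: "j \<in> J"
    then have Ij: "finite (I j)" "I j \<noteq> {}" "S \<inter> I j = {}"
      using I[OF j] assms(1,4) by (auto intro: finite_subset card_ge_0_finite)
    then have "finite (block_edges S (I j))"
      using fin by (auto simp: block_edges_def finite_imp_finite_nsets)
    then show "freq (block_edges S (I j)) (\<lambda>E. \<not> good_block l S (I j) E) \<le> ?b"
      using freq_good_block[OF fin(1) Ij, of l] I[OF j] by (simp add: freq_Not)
  qed
  finally show ?thesis by simp
qed

section \<open>Union bound over the ways to fail\<close>

text \<open>The four summands bound the probabilities of a large clique in \<open>V\<close>, a large
  clique in \<open>S\<close>, a poorly separated pair outside \<open>S\<close>, and the absence of a
  good block. As the block depends on the graph, the first and third events refer to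
  \<open>V\<close> and \<open>V - S\<close>, which contain the remainder \<open>R\<close> for every
  choice of block.\<close>

lemma freq_no_even_decomposition:
  fixes V :: "'a set"
  assumes V: "finite V" and S: "S \<subseteq> V" "S \<noteq> {}" and J: "finite J" and k: "k > 0"
    and I: "\<And>j. j \<in> J \<Longrightarrow> I j \<subseteq> V - S \<and> card (I j) = k"
    and disj: "\<And>i j. i \<in> J \<Longrightarrow> j \<in> J \<Longrightarrow> i \<noteq> j \<Longrightarrow> I i \<inter> I j = {}"
  shows "freq ([V]\<^bsup>2\<^esup>) (\<lambda>E. even (card E) \<and> \<not> has_even_decomposition V E) \<le>
    real (card V) ^ (L + 1) / 2 ^ ((L + 1) choose 2)
    + real (card S) ^ (l + 1) / 2 ^ ((l + 1) choose 2)
    + real (card V) ^ 2 * (real L * real (card S) ^ L / 2 ^ card S)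
    + (1 - 1 / 2 ^ (k choose 2) *
        (1 - real (card S) ^ 2 * (real (l + 1) * real k ^ (l + 1) / 2 ^ k))) ^ card J"
proof -
  let ?X = "[V]\<^bsup>2\<^esup>"
  have fin: "finite ?X" "finite S" using V S finite_subset by (auto simp: finite_imp_finite_nsets)
  define Q1 where "Q1 = (\<lambda>E :: 'a set set. \<exists>C\<subseteq>V. card C = L + 1 \<and> clique C E)"
  define Q2 where "Q2 = (\<lambda>E :: 'a set set. \<exists>C\<subseteq>S. card C = l + 1 \<and> clique C E)"
  define Q3 where "Q3 = (\<lambda>E. \<exists>u\<in>V - S. \<exists>v\<in>V - S. u \<noteq> v \<and> card (separators E u v S) < L)"
  define Q4 where "Q4 = (\<lambda>E. \<forall>j\<in>J. \<not> good_block (l + 1) S (I j) E)"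
  \<comment> \<open>Subsets of cliques are cliques, so excluding size exactly \<open>t + 1\<close>
    excludes all larger sizes.\<close>
  have small: "card C \<le> t" if "\<not> (\<exists>C\<subseteq>A. card C = t + 1 \<and> clique C E)" "C \<subseteq> A" "clique C E"
    for A C :: "'a set" and E t
  proof (rule ccontr)
    assume "\<not> card C \<le> t"
    then have "t + 1 \<le> card C" by simp
    then obtain D where "D \<subseteq> C" "card D = t + 1"
      by (meson obtain_subset_with_card_n)
    moreover from this have "clique D E" using that(3) by (auto simp: clique_def)
    ultimately show False using that by blast
  qed
  have "Q1 E \<or> Q2 E \<or> Q3 E \<or> Q4 E"
    if E: "E \<subseteq> ?X" "even (card E)" "\<not> has_even_decomposition V E" for E
  proof (rule ccontr)
    assume *: "\<not> ?thesis"
    then obtain j where j: "j \<in> J" "good_block (l + 1) S (I j) E" by (auto simp: Q4_def)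
    let ?R = "V - S - I j"
    interpret loopfree E
      by unfold_locales (use E in \<open>auto simp: nsets_def\<close>)
    have RSI: "?R \<union> S \<union> I j = V" using S I[OF j(1)] by auto
    have "has_even_decomposition (?R \<union> S \<union> I j) E"
    proof (rule even_decomposition_if_separated[where L = L and l = l])
      show "E \<subseteq> [?R \<union> S \<union> I j]\<^bsup>2\<^esup>" using E RSI by simp
      show "finite (I j)" using I[OF j(1)] V finite_subset by blast
      show "card C \<le> L" if "C \<subseteq> ?R" "clique C E" for C
        using small[of V L E C] * that by (auto simp: Q1_def)
      show "card C \<le> l" if "C \<subseteq> S" "clique C E" for C
        using small[of S l E C] * that by (auto simp: Q2_def)
      show "L \<le> card (separators E u v S)" if "u \<in> ?R" "v \<in> ?R" "u \<noteq> v" for u v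
        using * that unfolding Q3_def by (metis Diff_iff linorder_not_less)
    qed (use V fin E(2) j(2) I[OF j(1)] in \<open>auto simp: good_block_def\<close>)
    then show False using E RSI by simp
  qed
  then have "freq ?X (\<lambda>E. even (card E) \<and> \<not> has_even_decomposition V E) \<le>
      freq ?X (\<lambda>E. ((Q1 E \<or> Q2 E) \<or> Q3 E) \<or> Q4 E)"
    using fin by (intro freq_mono) auto
  also have "\<dots> \<le> freq ?X Q1 + freq ?X Q2 + freq ?X Q3 + freq ?X Q4"
    using freq_disj[OF fin(1), of "\<lambda>E. (Q1 E \<or> Q2 E) \<or> Q3 E" Q4]
      freq_disj[OF fin(1), of "\<lambda>E. Q1 E \<or> Q2 E" Q3] freq_disj[OF fin(1), of Q1 Q2] by linarith
  also have "freq ?X Q1 \<le> real (card V) ^ (L + 1) / 2 ^ ((L + 1) choose 2)"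
    unfolding Q1_def using V by (intro freq_clique) auto
  also have "freq ?X Q2 \<le> real (card S) ^ (l + 1) / 2 ^ ((l + 1) choose 2)"
    unfolding Q2_def using V S by (intro freq_clique) auto
  also have "freq ?X Q3 \<le> real (card V) ^ 2 * (real L * real (card S) ^ L / 2 ^ card S)"
  proof -
    have "freq ?X Q3 \<le> real (card (V - S)) ^ 2 * (real L * real (card S) ^ L / 2 ^ card S)"
      unfolding Q3_def using V S fin by (intro freq_some_pair_few_separators) auto
    also have "\<dots> \<le> real (card V) ^ 2 * (real L * real (card S) ^ L / 2 ^ card S)"
      using V by (intro mult_right_mono power_mono of_nat_mono card_mono) auto
    finally show ?thesis .
  qed
  also have "freq ?X Q4 \<le> (1 - 1 / 2 ^ (k choose 2) *
        (1 - real (card S) ^ 2 * (real (l + 1) * real k ^ (l + 1) / 2 ^ k))) ^ card J"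
    unfolding Q4_def using V S J k I disj by (intro freq_no_good_block) auto
  finally show ?thesis by simp
qed

section \<open>Choice of the parameters\<close>

lemma divide_two_power_le:
  fixes a :: real
  assumes "a \<le> 2 ^ x" "x + s \<le> y"
  shows "a / 2 ^ y \<le> 1 / 2 ^ s"
proof -
  have "a * 2 ^ s \<le> 2 ^ x * 2 ^ s" using assms(1) by (intro mult_right_mono) auto
  also have "\<dots> \<le> 2 ^ y" using assms(2) by (simp add: power_increasing flip: power_add)
  finally show ?thesis by (simp add: field_simps)
qed

lemma pow_le_two_pow: "real q ^ i \<le> 2 ^ (i * q)"
proof -
  have "real q ^ i \<le> (2 ^ q) ^ i" by (intro power_mono) (auto simp: less_imp_le of_nat_less_two_power)
  then show ?thesis by (simp add: mult.commute flip: power_mult)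
qed

text \<open>The scale is \<open>q\<close> of order \<open>(ln n) ^ (1/4)\<close>. Then
  \<open>L\<close> exceeds twice the binary logarithm of \<open>n\<close>, and \<open>S\<close> has
  size \<open>m = q ^ 6\<close>, which dominates the order \<open>q ^ 5\<close> of the exponent of
  \<open>m ^ L\<close>. Cliques of \<open>S\<close> are bounded by \<open>l\<close> of order
  \<open>q\<close>, and blocks have size \<open>k\<close> of order \<open>q ^ 2\<close>. Goodness of
  a block then costs an exponent of order \<open>q ^ 4\<close>, so \<open>n\<close> has room for
  enough disjoint blocks.\<close>

lemma freq_no_even_decomposition_le:
  fixes q n :: nat
  assumes q: "q \<ge> 3000000" and n: "2 ^ (10000 * q ^ 4) \<le> n" "n \<le> 2 ^ (160000 * q ^ 4)"
  shows "freq ([{1..n}]\<^bsup>2\<^esup>) (\<lambda>E. even (card E) \<and> \<not> has_even_decomposition {1..n} E)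
    \<le> 3 / 2 ^ q\<^sup>2 + exp (- (real q ^ 2))"
proof -
  define L where "L = 340000 * q ^ 4"
  define l where "l = 16 * q"
  define m where "m = q ^ 6"
  define k where "k = 100 * q\<^sup>2"
  define B where "B = k choose 2"
  define N where "N = q\<^sup>2 * 2 ^ (B + 1)"
  define I where "I = (\<lambda>j. {m + j * k<..m + Suc j * k})"
  have nR: "real n \<le> 2 ^ (160000 * q ^ 4)"
    using n(2) by (metis of_nat_le_iff of_nat_numeral of_nat_power)
  have q1: "1 \<le> q" using q by simp
  have pow: "q ^ i \<le> q ^ j" if "i \<le> j" for i j
    using q1 that by (intro power_increasing) auto
  have mR: "real m \<le> 2 ^ (6 * q)"
    using pow_le_two_pow[of q 6] by (simp add: m_def)
  have kR: "real k \<le> 2 ^ (3 * q)"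
  proof -
    have "real k \<le> 2 ^ 7 * 2 ^ (2 * q)"
      unfolding k_def of_nat_mult using pow_le_two_pow[of q 2] by (intro mult_mono) auto
    also have "\<dots> \<le> 2 ^ (3 * q)"
      unfolding power_add[symmetric] using q by (intro power_increasing) auto
    finally show ?thesis .
  qed

  have "L + 1 choose 2 = (L + 1) * (170000 * q ^ 4)"
  proof -
    have "(L + 1) * L = 2 * ((L + 1) * (170000 * q ^ 4))" by (simp add: L_def)
    then show ?thesis by (simp add: choose_two)
  qed
  moreover have "real n ^ (L + 1) \<le> 2 ^ (160000 * q ^ 4 * (L + 1))"
    unfolding power_mult[of 2 "160000 * q ^ 4"] using nR by (intro power_mono) auto
  moreover have "160000 * q ^ 4 * (L + 1) + q\<^sup>2 \<le> (L + 1) * (170000 * q ^ 4)"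
    using pow[of 2 4] by (simp add: algebra_simps)
  ultimately have 1: "real n ^ (L + 1) / 2 ^ (L + 1 choose 2) \<le> 1 / 2 ^ q\<^sup>2"
    using divide_two_power_le by metis

  have "l + 1 choose 2 = (l + 1) * (8 * q)"
  proof -
    have "(l + 1) * l = 2 * ((l + 1) * (8 * q))" by (simp add: l_def)
    then show ?thesis by (simp add: choose_two)
  qed
  moreover have "real m ^ (l + 1) \<le> 2 ^ (6 * q * (l + 1))"
    unfolding power_mult[of 2 "6 * q"] using mR by (intro power_mono) auto
  moreover have "6 * q * (l + 1) + q\<^sup>2 \<le> (l + 1) * (8 * q)"
    by (simp add: l_def algebra_simps power2_eq_square)
  ultimately have 2: "real m ^ (l + 1) / 2 ^ (l + 1 choose 2) \<le> 1 / 2 ^ q\<^sup>2"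
    using divide_two_power_le by metis

  have "real n ^ 2 * (real L * real m ^ L) \<le> 2 ^ (160000 * q ^ 4 * 2) * (2 ^ L * 2 ^ (6 * q * L))"
    unfolding power_mult[of 2 "160000 * q ^ 4"] power_mult[of 2 "6 * q"]
    using nR mR by (intro mult_mono power_mono) (auto simp: less_imp_le of_nat_less_two_power)
  then have "real n ^ 2 * (real L * real m ^ L) \<le> 2 ^ (320000 * q ^ 4 + L + 6 * q * L)"
    by (simp add: power_add mult_ac)
  moreover have "320000 * q ^ 4 + L + 6 * q * L + q\<^sup>2 \<le> m"
  proof -
    have "6 * q * L = 2040000 * q ^ 5" "m = q * q ^ 5"
      by (simp_all add: L_def m_def power_numeral_reduce)
    \<comment> \<open>The lower bound on \<open>q\<close> originates here: the left-hand side of the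
      goal is at most \<open>2700001 * q ^ 5\<close>.\<close>
    moreover have "3000000 * q ^ 5 \<le> q * q ^ 5" using q by (intro mult_right_mono) auto
    ultimately show ?thesis
      using pow[of 2 5] pow[of 4 5] L_def by linarith
  qed
  ultimately have "real n ^ 2 * (real L * real m ^ L) / 2 ^ m \<le> 1 / 2 ^ q\<^sup>2"
    by (rule divide_two_power_le)
  then have 3: "real n ^ 2 * (real L * real m ^ L / 2 ^ m) \<le> 1 / 2 ^ q\<^sup>2" by simp

  \<comment> \<open>An upper bound for the probability that some pair in \<open>S\<close> is poorly
    separated by a fixed block. Once it is at most one half, a block is good with probability at
    least \<open>1 / 2 ^ (B + 1)\<close>.\<close>
  define y where "y = real m ^ 2 * (real (l + 1) * real k ^ (l + 1) / 2 ^ k)"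
  have "real m ^ 2 * (real (l + 1) * real k ^ (l + 1)) \<le>
      2 ^ (6 * q * 2) * (2 ^ (l + 1) * 2 ^ (3 * q * (l + 1)))"
    unfolding power_mult[of 2 "6 * q"] power_mult[of 2 "3 * q"]
    using mR kR less_imp_le[OF of_nat_less_two_power[of "l + 1"]]
    by (intro mult_mono power_mono) auto
  then have "real m ^ 2 * (real (l + 1) * real k ^ (l + 1)) \<le> 2 ^ (12 * q + (l + 1) + 3 * q * (l + 1))"
    by (simp add: power_add mult_ac)
  moreover have "12 * q + (l + 1) + 3 * q * (l + 1) + 1 \<le> k"
  proof -
    have "12 * q + (l + 1) + 3 * q * (l + 1) + 1 = 48 * q\<^sup>2 + 31 * q + 2"
      by (simp add: l_def algebra_simps power2_eq_square)
    moreover have "q \<le> q\<^sup>2" using pow[of 1 2] by simp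
    ultimately show ?thesis using q k_def by linarith
  qed
  ultimately have "real m ^ 2 * (real (l + 1) * real k ^ (l + 1)) / 2 ^ k \<le> 1 / 2 ^ 1"
    by (rule divide_two_power_le)
  then have y: "0 \<le> y" "y \<le> 1 / 2" by (auto simp: y_def)
  have "(1 - 1 / 2 ^ B * (1 - y)) ^ N \<le> (1 - 1 / 2 ^ (B + 1)) ^ N"
  proof (rule power_mono)
    have "1 / 2 ^ B * (1 - y) \<le> 1 / 2 ^ B * 1" using y by (intro mult_left_mono) auto
    also have "\<dots> \<le> 1" by simp
    finally show "0 \<le> 1 - 1 / 2 ^ B * (1 - y)" by simp
    have "1 / 2 ^ B * (1 / 2) \<le> 1 / 2 ^ B * (1 - y)" using y by (intro mult_left_mono) auto
    then show "1 - 1 / 2 ^ B * (1 - y) \<le> 1 - 1 / 2 ^ (B + 1)" by simp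
  qed
  also have "\<dots> \<le> exp (- (1 / 2 ^ (B + 1))) ^ N"
    using exp_ge_add_one_self[of "- (1 / 2 ^ (B + 1))"] one_le_power[of "2 :: real" "B + 1"]
    by (intro power_mono) auto
  \<comment> \<open>\<open>N\<close> is chosen as \<open>q ^ 2\<close> times the inverse of this
    probability, so the exponents multiply to exactly \<open>q ^ 2\<close>.\<close>
  also have "\<dots> = exp (- (real q ^ 2))"
    by (simp add: N_def flip: exp_of_nat_mult)
  finally have 4: "(1 - 1 / 2 ^ B * (1 - y)) ^ N \<le> exp (- (real q ^ 2))" .

  \<comment> \<open>The set \<open>{1..m}\<close> and \<open>N\<close> consecutive intervals of
    length \<open>k\<close> fit into \<open>{1..n}\<close>: \<open>B\<close> is at most
    \<open>5000 * q ^ 4\<close>, half the exponent guaranteed for \<open>n\<close>, and the slack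
    absorbs the other factors.\<close>
  have "m + N * k \<le> n"
  proof -
    have "B = 50 * q\<^sup>2 * (k - 1)" unfolding B_def choose_two k_def by simp
    also have "\<dots> \<le> 50 * q\<^sup>2 * k" by (intro mult_left_mono) auto
    finally have B: "B \<le> 5000 * q ^ 4" by (simp add: k_def power_numeral_reduce power2_eq_square)
    have "real (N * k) \<le> 2 ^ (2 * q) * 2 ^ (B + 1) * 2 ^ (3 * q)"
      unfolding N_def of_nat_mult using pow_le_two_pow[of q 2] kR
      by (intro mult_mono) auto
    also have "\<dots> = 2 ^ (2 * q + (B + 1) + 3 * q)" by (simp only: power_add)
    finally have "real m + real (N * k) \<le> 2 ^ (6 * q) + 2 ^ (2 * q + (B + 1) + 3 * q)"
      using mR by linarith
    also have "\<dots> \<le> 2 ^ (10000 * q ^ 4 - 1) + 2 ^ (10000 * q ^ 4 - 1)"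
    proof (intro add_mono power_increasing)
      have "q \<le> q ^ 4" "1 \<le> q ^ 4" using pow[of 1 4] q1 by auto
      then show "6 * q \<le> 10000 * q ^ 4 - 1" "2 * q + (B + 1) + 3 * q \<le> 10000 * q ^ 4 - 1"
        using B by linarith+
    qed auto
    also have "\<dots> = 2 ^ (10000 * q ^ 4)"
      using q1 power_Suc[of "2 :: real" "10000 * q ^ 4 - 1"] by simp
    also have "\<dots> \<le> real n"
      using n(1) by (metis of_nat_le_iff of_nat_numeral of_nat_power)
    finally show ?thesis by linarith
  qed
  have Isub: "I j \<subseteq> {1..n} - {1..m} \<and> card (I j) = k" if "j \<in> {..<N}" for j
  proof -
    have "Suc j * k \<le> N * k" using that by (intro mult_right_mono) auto
    then show ?thesis using \<open>m + N * k \<le> n\<close> by (auto simp: I_def)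
  qed
  have Idisj: "I i \<inter> I j = {}" if "i \<noteq> j" for i j
  proof -
    have "I i \<inter> I j = {}" if "i < j" for i j
    proof -
      have "Suc i * k \<le> j * k" using that by (intro mult_right_mono) auto
      then show ?thesis by (auto simp: I_def)
    qed
    then show ?thesis using that by (metis inf_commute nat_neq_iff)
  qed
  have "m \<le> n" using \<open>m + N * k \<le> n\<close> by simp
  have "m > 0" "k > 0" using q by (auto simp: m_def k_def)
  have "freq ([{1..n}]\<^bsup>2\<^esup>) (\<lambda>E. even (card E) \<and> \<not> has_even_decomposition {1..n} E) \<le>
      real (card {1..n}) ^ (L + 1) / 2 ^ ((L + 1) choose 2)
    + real (card {1..m}) ^ (l + 1) / 2 ^ ((l + 1) choose 2)
    + real (card {1..n}) ^ 2 * (real L * real (card {1..m}) ^ L / 2 ^ card {1..m})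
    + (1 - 1 / 2 ^ (k choose 2) *
        (1 - real (card {1..m}) ^ 2 * (real (l + 1) * real k ^ (l + 1) / 2 ^ k))) ^ card {..<N}"
    using \<open>m \<le> n\<close> \<open>m > 0\<close> \<open>k > 0\<close> Isub Idisj
    by (intro freq_no_even_decomposition[where I = I]) auto
  then have "freq ([{1..n}]\<^bsup>2\<^esup>) (\<lambda>E. even (card E) \<and> \<not> has_even_decomposition {1..n} E) \<le>
      real n ^ (L + 1) / 2 ^ (L + 1 choose 2) + real m ^ (l + 1) / 2 ^ (l + 1 choose 2)
      + real n ^ 2 * (real L * real m ^ L / 2 ^ m) + (1 - 1 / 2 ^ B * (1 - y)) ^ N"
    by (simp only: card_atLeastAtMost card_lessThan B_def y_def diff_Suc_1 add_diff_cancel_right' Suc_eq_plus1)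
  also have "\<dots> \<le> 1 / 2 ^ q\<^sup>2 + 1 / 2 ^ q\<^sup>2 + 1 / 2 ^ q\<^sup>2 + exp (- (real q ^ 2))"
    using 1 2 3 4 by (intro add_mono)
  finally show ?thesis by simp
qed

section \<open>Passing from the scale to all large \<open>n\<close>\<close>

theorem theorem1p6:
  shows "\<exists>c::real. \<exists>n0::nat. c > 0 \<and>
    (\<forall>n\<ge>n0.
      real (card {E \<in> simple_graphs {1..n}. even (card E) \<and> \<not> has_even_decomposition {1..n} E})
        \<le> 2 ^ (n choose 2) * exp (- c * sqrt (ln (real n))))"
\<comment> \<open>The constant must satisfy \<open>400 * c < 1 / 2\<close>: below,
  \<open>sqrt (ln n)\<close> is at most \<open>400 * q ^ 2\<close>, while the probability decays
  like \<open>exp (- q ^ 2 / 2)\<close>. The threshold forces \<open>q\<close> to be at least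
  \<open>3000000\<close>.\<close>
proof (intro exI[of _ "1 / 1000"] exI[of _ "2 ^ (10000 * 3000000 ^ 4)"] conjI allI impI)
  fix n :: nat
  assume n: "2 ^ (10000 * 3000000 ^ 4) \<le> n"
  \<comment> \<open>The predecessor \<open>q\<close> of this least exponent brackets
    \<open>n\<close>: minimality gives the lower bound, and \<open>p \<le> 2 * q\<close> turns the
    upper bound into one in terms of \<open>q\<close>.\<close>
  define p where "p = (LEAST p. n < 2 ^ (10000 * p ^ 4))"
  have "n < 2 ^ n" by (rule less_exp)
  also have "(2 :: nat) ^ n \<le> 2 ^ (10000 * n ^ 4)"
    using self_le_power[of n 4] by (intro power_increasing) (cases "n = 0"; simp)+
  finally have p: "n < 2 ^ (10000 * p ^ 4)"
    unfolding p_def by (rule LeastI)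
  have p_min: "2 ^ (10000 * i ^ 4) \<le> n" if "i < p" for i
    using not_less_Least[OF that[unfolded p_def]] by simp
  have "3000000 < p"
  proof (rule ccontr)
    assume "\<not> ?thesis"
    then have "(2 :: nat) ^ (10000 * p ^ 4) \<le> 2 ^ (10000 * 3000000 ^ 4)"
      by (intro power_increasing mult_left_mono power_mono) auto
    with p n show False by linarith
  qed
  then obtain q where q: "p = Suc q" "q \<ge> 3000000" by (cases p) auto
  have "p ^ 4 \<le> (2 * q) ^ 4" using q by (intro power_mono) auto
  then have "(2 :: nat) ^ (10000 * p ^ 4) \<le> 2 ^ (160000 * q ^ 4)"
    by (intro power_increasing) (auto simp: power_mult_distrib)
  then have n_le: "n \<le> 2 ^ (160000 * q ^ 4)" using p by linarith
  have "n > 0" using n by (metis gr0I not_le zero_less_numeral zero_less_power)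
  have "ln (real n) \<le> ln (2 ^ (160000 * q ^ 4))"
    using n_le \<open>n > 0\<close> by (metis ln_mono of_nat_0_less_iff of_nat_le_iff of_nat_numeral of_nat_power)
  also have "\<dots> = real (160000 * q ^ 4) * ln 2" by (simp add: ln_realpow)
  also have "\<dots> \<le> real (160000 * q ^ 4) * 1"
    using ln_2_less_1 by (intro mult_left_mono) auto
  also have "\<dots> = (400 * real q ^ 2) ^ 2" by (simp add: power_mult_distrib)
  finally have sqrt_le: "sqrt (ln (real n)) \<le> 400 * real q ^ 2"
    by (simp add: real_le_lsqrt)
  have "10 \<le> real q ^ 2 * (1 / 10)"
  proof -
    have "100 * 1 \<le> real q * real q" using q(2) by (intro mult_mono) auto
    then show ?thesis by (simp add: power2_eq_square)
  qed
  have two: "1 / 2 ^ q\<^sup>2 \<le> exp (- (1 / 2) * real q ^ 2)"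
  proof -
    have "(1 :: real) / 2 ^ q\<^sup>2 = exp (- (ln 2 * real q ^ 2))"
      by (simp add: exp_minus exp_of_nat2_mult field_simps flip: of_nat_power)
    also have "\<dots> \<le> exp (- (1 / 2) * real q ^ 2)"
      using ln_le_minus_one[of "1 / 2"] mult_right_mono[of "1 / 2" "ln 2" "real q ^ 2"]
      by (simp add: ln_div)
    finally show ?thesis .
  qed
  let ?f = "freq ([{1..n}]\<^bsup>2\<^esup>) (\<lambda>E. even (card E) \<and> \<not> has_even_decomposition {1..n} E)"
  have "?f \<le> 3 / 2 ^ q\<^sup>2 + exp (- (real q ^ 2))"
    using q(2) p_min[of q] q(1) n_le by (intro freq_no_even_decomposition_le) auto
  also have "\<dots> \<le> 3 * exp (- (1 / 2) * real q ^ 2) + exp (- (1 / 2) * real q ^ 2)"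
    using two by (intro add_mono) auto
  also have "\<dots> = 4 * exp (- (1 / 2) * real q ^ 2)" by simp
  \<comment> \<open>The factor 4 is moved into the exponent, where the gap between
    \<open>1 / 2\<close> and \<open>400 / 1000\<close> absorbs it.\<close>
  also have "\<dots> \<le> exp 4 * exp (- (1 / 2) * real q ^ 2)"
    using exp_ge_add_one_self[of 4] by (intro mult_right_mono) auto
  also have "\<dots> = exp (4 - (1 / 2) * real q ^ 2)" by (simp flip: exp_add)
  also have "\<dots> \<le> exp (- (1 / 1000) * sqrt (ln (real n)))"
    unfolding exp_le_cancel_iff using sqrt_le \<open>10 \<le> real q ^ 2 * (1 / 10)\<close> by simp
  finally have "?f \<le> exp (- (1 / 1000) * sqrt (ln (real n)))" .
  moreover have "real (card {E \<in> simple_graphs {1..n}. even (card E) \<and> \<not> has_even_decomposition {1..n} E})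
      = 2 ^ (n choose 2) * ?f"
    by (simp add: freq_def simple_graphs_def)
  ultimately show "real (card {E \<in> simple_graphs {1..n}. even (card E) \<and> \<not> has_even_decomposition {1..n} E})
        \<le> 2 ^ (n choose 2) * exp (- (1 / 1000) * sqrt (ln (real n)))"
    by (simp add: mult_left_mono)
qed simp

end
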